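(* Let $n\ge 2$, let $C_3$ be the cycle on $3$ vertices and $P_n$ the path on $n$ vertices. Then $\mathrm{mr}_+(C_3\,\Box\,P_n)=3n-3$, i.e. $\mathrm{mr}_+^{\mathbb{R}}(C_3\,\Box\,P_n)=\mathrm{mr}_+^{\mathbb{C}}(C_3\,\Box\,P_n)=3n-3$.
   Context: For an $N\times N$ Hermitian matrix $A$, $\mathcal{G}(A)$ is the simple graph on $\{1,\dots,N\}$ in which distinct $i,j$ are adjacent iff $A_{ij}\ne0$ (the diagonal is unconstrained). For a simple graph $G$ on $N$ vertices, $\mathrm{mr}_+^{\mathbb{R}}(G)$ (resp. $\mathrm{mr}_+^{\mathbb{C}}(G)$) is the minimum rank of a real symmetric (resp. complex Hermitian) positive semidefinite $N\times N$ matrix $B$ with $\mathcal{G}(B)=G$. If the two numbers are equal, the common value is denoted $\mathrm{mr}_+(G)$. The Cartesian product $G_1\,\Box\,G_2$ of $G_1=(V_1,E_1)$ and $G_2=(V_2,E_2)$ has vertex set $V_1\times V_2$, with $(u,v)$ adjacent to $(u',v')$ iff (1) $u=u'$ and $\{v,v'\}\in E_2$, or (2) $v=v'$ and $\{u,u'\}\in E_1$. *)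

theory Defs
  imports
    "Jordan_Normal_Form.DL_Rank"
    "Jordan_Normal_Form.Schur_Decomposition"
    "Graph_Theory.Graph_Theory"
begin

text \<open>Simple graphs are \<^const>\<open>pair_graph\<close>s: finite, symmetric and loop-free, with edge
  \<open>{u, v}\<close> represented by the two arcs \<open>(u, v)\<close> and \<open>(v, u)\<close>.\<close>

definition path_graph :: "nat \<Rightarrow> nat pair_pre_digraph" where
  "path_graph n = \<lparr> pverts = {..<n},
     parcs = {(i, j). i < n \<and> j < n \<and> (j = Suc i \<or> i = Suc j)} \<rparr>"

text \<open>Meaningful for \<open>n \<ge> 3\<close> only.\<close>

definition cycle_graph :: "nat \<Rightarrow> nat pair_pre_digraph" where
  "cycle_graph n = \<lparr> pverts = {..<n},
     parcs = {(i, j). i < n \<and> j < n \<and> (j = Suc i mod n \<or> i = Suc j mod n)} \<rparr>"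

definition cart_prod ::
  "'a pair_pre_digraph \<Rightarrow> 'b pair_pre_digraph \<Rightarrow> ('a \<times> 'b) pair_pre_digraph" (infixr \<open>\<box>\<close> 70) where
  "G \<box> H = \<lparr> pverts = pverts G \<times> pverts H,
     parcs = {((u, v), (u', v')).
       (u = u' \<and> u \<in> pverts G \<and> (v, v') \<in> parcs H) \<or>
       (v = v' \<and> v \<in> pverts H \<and> (u, u') \<in> parcs G)} \<rparr>"

text \<open>Rows and columns of \<^typ>\<open>'a mat\<close> are numbered from \<open>0\<close>, so the vertex set
  is \<open>{0, \<dots>, N - 1}\<close>.\<close>

definition mat_graph :: "'a::zero mat \<Rightarrow> nat pair_pre_digraph" where
  "mat_graph A = \<lparr> pverts = {..<dim_row A},
     parcs = {(i, j). i < dim_row A \<and> j < dim_row A \<and> i \<noteq> j \<and> A $$ (i, j) \<noteq> 0} \<rparr>"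

text \<open>Conjugation is the identity on \<^typ>\<open>real\<close>, so there Hermitian means symmetric. On
  \<^typ>\<open>complex\<close>, \<open>0 \<le> z\<close> means that \<open>z\<close> is real and nonnegative.\<close>

definition hermitian_mat :: "nat \<Rightarrow> 'a::conjugatable_field mat \<Rightarrow> bool" where
  "hermitian_mat N A \<longleftrightarrow> A \<in> carrier_mat N N \<and> mat_adjoint A = A"

definition psd_mat :: "nat \<Rightarrow> 'a::conjugatable_ordered_field mat \<Rightarrow> bool" where
  "psd_mat N A \<longleftrightarrow> hermitian_mat N A \<and> (\<forall>v \<in> carrier_vec N. 0 \<le> (A *\<^sub>v v) \<bullet>c v)"

text \<open>The vertices of \<open>G\<close> need not be numbers, so \<open>mat_graph B\<close> is required to be \<open>G\<close> up to a
  numbering of the vertices, that is, up to isomorphism.\<close>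

definition mr_plus :: "'k::conjugatable_ordered_field itself \<Rightarrow> 'v pair_pre_digraph \<Rightarrow> nat" where
  "mr_plus (_ :: 'k itself) G =
     (let N = card (pverts G) in
      Inf {vec_space.rank N B | B :: 'k mat.
             psd_mat N B \<and> digraph_iso (with_proj (mat_graph B)) (with_proj G)})"

lemma pair_graph_path_graph: "pair_graph (path_graph n)"
proof -
  have "finite (parcs (path_graph n))"
    by (rule finite_subset[of _ "{..<n} \<times> {..<n}"]) (auto simp: path_graph_def)
  then show ?thesis
    by unfold_locales (auto simp: path_graph_def symmetric_def intro!: symI)
qed

lemma pair_graph_cycle_graph:
  assumes "n \<ge> 3"
  shows "pair_graph (cycle_graph n)"
proof -
  have "finite (parcs (cycle_graph n))"
    by (rule finite_subset[of _ "{..<n} \<times> {..<n}"]) (auto simp: cycle_graph_def)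
  then show ?thesis using assms
    by unfold_locales (auto simp: cycle_graph_def symmetric_def mod_Suc intro!: symI split: if_splits)
qed

lemma pair_graph_cart_prod:
  assumes "pair_graph G" "pair_graph H"
  shows "pair_graph (G \<box> H)"
proof -
  interpret G: pair_graph G by fact
  interpret H: pair_graph H by fact
  have sub: "parcs (G \<box> H) \<subseteq> (pverts G \<times> pverts H) \<times> (pverts G \<times> pverts H)"
    by (auto simp: cart_prod_def dest: G.in_arcsD1 G.in_arcsD2 H.in_arcsD1 H.in_arcsD2)
  have verts: "pverts (G \<box> H) = pverts G \<times> pverts H"
    by (simp add: cart_prod_def)
  have fin: "finite (pverts G \<times> pverts H)"
    using G.pair_finite_verts H.pair_finite_verts by simp
  have "sym (parcs G)" "sym (parcs H)"
    using G.pair_sym_arcs H.pair_sym_arcs by (simp_all add: symmetric_def)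
  then have "sym (parcs (G \<box> H))"
    unfolding sym_def by (simp add: cart_prod_def) blast
  moreover have "finite (parcs (G \<box> H))"
    by (rule finite_subset[OF sub finite_cartesian_product[OF fin fin]])
  moreover have "fst e \<noteq> snd e" if "e \<in> parcs (G \<box> H)" for e
    using that G.pair_no_loops H.pair_no_loops by (fastforce simp: cart_prod_def)
  ultimately show ?thesis
    using sub fin by unfold_locales (auto simp: verts symmetric_def)
qed

lemma hermitian_mat_iff:
  "hermitian_mat N A \<longleftrightarrow>
     A \<in> carrier_mat N N \<and> (\<forall>i<N. \<forall>j<N. A $$ (i, j) = conjugate (A $$ (j, i)))"
proof (cases "A \<in> carrier_mat N N")
  case True
  then have "mat_adjoint A = mat N N (\<lambda>(i,j). conjugate (A $$ (j, i)))"
    by (intro eq_matI) (auto simp: mat_adjoint_def mat_of_rows_def)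
  then have "mat_adjoint A = A \<longleftrightarrow> (\<forall>i<N. \<forall>j<N. conjugate (A $$ (j, i)) = A $$ (i, j))"
    using True by (simp add: mat_eq_iff)
  with True show ?thesis unfolding hermitian_mat_def by metis
qed (simp add: hermitian_mat_def)

lemma pair_graph_mat_graph:
  assumes "hermitian_mat N A"
  shows "pair_graph (mat_graph A)"
proof -
  have "finite (parcs (mat_graph A))"
    by (rule finite_subset[of _ "{..<dim_row A} \<times> {..<dim_row A}"]) (auto simp: mat_graph_def)
  moreover have "A $$ (j, i) \<noteq> 0" if "i < dim_row A" "j < dim_row A" "A $$ (i, j) \<noteq> 0" for i j
    using that assms unfolding hermitian_mat_iff by (metis carrier_matD(1) conjugate_zero)
  ultimately show ?thesis
    by unfold_locales (auto simp: mat_graph_def symmetric_def intro!: symI)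
qed

end

theory Submission
  imports Defs
begin

text \<open>Number the vertices layer by layer. In a matrix with graph \<open>C\<^sub>3 \<box> P\<^sub>n\<close>, the rows of the
  layers \<open>0, \<dots>, n - 2\<close> and the columns of the layers \<open>1, \<dots>, n - 1\<close> form a triangular matrix with
  nonzero diagonal, so the rank is at least \<open>3n - 3\<close>, whatever the signature. Conversely, let \<open>J\<close> be
  the all-ones matrix of size \<open>3\<close>, \<open>P = J - I\<close> and \<open>Q = 2(J - 2I)\<close>, so that \<open>PQ = 4I\<close>. If \<open>W\<close> has
  \<open>n - 1\<close> block rows, the \<open>k\<close>-th one being zero except for \<open>P\<close> and \<open>Q\<close> in the block columns \<open>k\<close>
  and \<open>k + 1\<close>, then \<open>W\<^sup>T W\<close> is positive semidefinite of rank at most \<open>3n - 3\<close>. Neighbouring layers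
  are joined by the block \<open>PQ = 4I\<close>, and the off-diagonal entries inside a layer are \<open>1\<close>, \<open>-4\<close> or
  \<open>1 - 4\<close>, hence nonzero.\<close>

subsection \<open>Rank bounds\<close>

context vec_space
begin

text \<open>Read a dependency among the columns \<open>c j\<close> in the row \<open>r i\<close>,
  where \<open>i\<close> is the first index with nonzero coefficient: earlier terms vanish by
  minimality and later ones by \<open>upper\<close>, which contradicts \<open>diag\<close>.\<close>

lemma rank_ge_triangular:
  assumes A: "A \<in> carrier_mat n nc"
    and r: "\<And>i. i < m \<Longrightarrow> r i < n" and c: "\<And>i. i < m \<Longrightarrow> c i < nc"
    and diag: "\<And>i. i < m \<Longrightarrow> A $$ (r i, c i) \<noteq> 0"
    and upper: "\<And>i j. i < j \<Longrightarrow> j < m \<Longrightarrow> A $$ (r i, c j) = 0"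
  shows "m \<le> rank A"
proof -
  define C where "C = mat n m (\<lambda>(k, j). A $$ (k, c j))"
  have C: "C \<in> carrier_mat n m" by (simp add: C_def)
  have col_C: "col C j = col A (c j)" if "j < m" for j
    using that A c[OF that] by (intro eq_vecI) (auto simp: C_def)
  \<comment> \<open>Both the kernel vector from \<open>lin_depE\<close> and the final cardinality
    count require a list of columns without repetition.\<close>
  have distinct: "distinct (cols C)"
  proof -
    have "col C i \<noteq> col C j" if "i < j" "j < m" for i j
    proof
      assume "col C i = col C j"
      then have "col C i $ r i = col C j $ r i" by simp
      then have "A $$ (r i, c i) = A $$ (r i, c j)" using that r[of i] by (simp add: C_def)
      then show False using diag[of i] upper[OF that] that by simp
    qed
    then show ?thesis using C
      by (auto simp: distinct_conv_nth neq_iff) metis+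
  qed
  have "lin_indpt (set (cols C))"
  proof
    assume "lin_dep (set (cols C))"
    then obtain v where v: "v \<in> carrier_vec m" "v \<noteq> 0\<^sub>v m" "C *\<^sub>v v = 0\<^sub>v n"
      using lin_depE[OF C _ distinct] by blast
    then have ex: "\<exists>i. i < m \<and> v $ i \<noteq> 0" by (metis carrier_vecD eq_vecI index_zero_vec)
    define i where "i = (LEAST i. i < m \<and> v $ i \<noteq> 0)"
    have i: "i < m" "v $ i \<noteq> 0" using LeastI_ex[OF ex] by (auto simp: i_def)
    have less: "v $ j = 0" if "j < i" for j
      using not_less_Least[of j "\<lambda>i. i < m \<and> v $ i \<noteq> 0"] that i by (auto simp: i_def)
    have "0 = (C *\<^sub>v v) $ r i" using v(3) r[OF i(1)] by simp
    also have "\<dots> = (\<Sum>j\<in>{0..<m}. A $$ (r i, c j) * v $ j)"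
      using C v(1) r[OF i(1)] by (simp add: scalar_prod_def C_def)
    also have "\<dots> = (\<Sum>j\<in>{0..<m}. if j = i then A $$ (r i, c i) * v $ i else 0)"
      using less upper by (intro sum.cong) (auto simp: neq_iff)
    also have "\<dots> = A $$ (r i, c i) * v $ i" using i by simp
    finally show False using diag i by simp
  qed
  moreover have "set (cols C) \<subseteq> set (cols A)"
    using A C c by (auto simp: cols_def col_C)
  moreover have "card (set (cols C)) = m"
    using distinct_card[OF distinct] C by simp
  ultimately show ?thesis using rank_ge_card_indpt[OF A] by metis
qed

lemma mult_mat_vec_in_span_cols:
  assumes "A \<in> carrier_mat n nc" "v \<in> carrier_vec nc"
  shows "A *\<^sub>v v \<in> span (set (cols A))"
proof -
  have cols: "set (cols A) \<subseteq> carrier_vec n" using assms(1) cols_dim by blast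
  have "lincomb_list (vec_index v) (cols A) = mat_of_cols n (cols A) *\<^sub>v vec (length (cols A)) (vec_index v)"
    using cols by (intro lincomb_list_as_mat_mult) auto
  also have "\<dots> = A *\<^sub>v v" using assms by (auto intro!: arg_cong2[where f = mult_mat_vec])
  finally show ?thesis
    using in_span_listI[OF _ refl, of "vec_index v" "cols A"] span_list_as_span[OF cols] by simp
qed

text \<open>All columns of the product lie in the span of the at most \<open>k\<close> columns of
  \<open>A\<close>, so the exchange lemma bounds every independent set of them.\<close>

lemma rank_mult_le:
  assumes A: "A \<in> carrier_mat n k" and B: "B \<in> carrier_mat k nc"
  shows "rank (A * B) \<le> k"
proof -
  have AB: "A * B \<in> carrier_mat n nc" using A B by simp
  obtain S where S: "maximal S (\<lambda>T. T \<subseteq> set (cols (A * B)) \<and> lin_indpt T)"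
    using maximal_exists_superset[of "set (cols (A * B))"
        "\<lambda>T. T \<subseteq> set (cols (A * B)) \<and> lin_indpt T" "{}"] finite_lin_indpt2[of "{}"] by auto
  then have sub: "S \<subseteq> set (cols (A * B))" and indpt: "lin_indpt S" by (auto simp: maximal_def)
  have "col (A * B) j \<in> span (set (cols A))" if "j < nc" for j
    unfolding col_mult2[OF A B that] using B that by (intro mult_mat_vec_in_span_cols[OF A]) auto
  then have "set (cols (A * B)) \<subseteq> span (set (cols A))"
    using AB by (auto simp: cols_def simp del: col_mult2)
  with sub have "S \<subseteq> span (set (cols A))" by blast
  moreover have "finite S" using sub finite_subset by blast
  moreover have "set (cols A) \<subseteq> carrier V" using A cols_dim[of A] by simp
  \<comment> \<open>The exchange bound is stated in \<open>int\<close>; since \<open>card C\<close>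
    is nonnegative, so is the difference on the right.\<close>
  ultimately obtain C :: "'a vec set" where "int (card C) \<le> int (card (set (cols A))) - int (card S)"
    using replacement[of S "set (cols A)"] indpt by auto
  then have "card S \<le> card (set (cols A))" by linarith
  also have "\<dots> \<le> k" using A card_length[of "cols A"] by simp
  finally show ?thesis using rank_card_indpt[OF AB S] by simp
qed

end

subsection \<open>Gram matrices\<close>

lemma mat_adjoint_eq:
  assumes "W \<in> carrier_mat m n"
  shows "mat_adjoint W = mat n m (\<lambda>(i, j). conjugate (W $$ (j, i)))"
  using assms by (intro eq_matI) (auto simp: mat_adjoint_def mat_of_rows_def)

text \<open>The quadratic form at \<open>v\<close> is the squared norm of
  \<open>W *\<^sub>v v\<close>.\<close>

lemma psd_mat_gram:
  fixes W :: "'k::conjugatable_ordered_field mat"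
  assumes W: "W \<in> carrier_mat m n"
  shows "psd_mat n (mat_adjoint W * W)"
proof -
  note adj = mat_adjoint_eq[OF W]
  have adj_carrier: "mat_adjoint W \<in> carrier_mat n m" by (simp add: adj)
  have "hermitian_mat n (mat_adjoint W * W)"
    using W by (auto simp: hermitian_mat_iff adj scalar_prod_def sum_conjugate conjugate_dist_mul
        mult.commute intro!: sum.cong)
  moreover have "0 \<le> ((mat_adjoint W * W) *\<^sub>v v) \<bullet>c v" if v: "v \<in> carrier_vec n" for v
  proof -
    define u where "u = W *\<^sub>v v"
    have u: "u \<in> carrier_vec m" using W v by (simp add: u_def)
    have "(mat_adjoint W * W) *\<^sub>v v = mat_adjoint W *\<^sub>v u"
      using adj_carrier W v by (simp add: u_def)
    also have "\<dots> \<bullet>c v = (\<Sum>i<n. \<Sum>k<m. conjugate (W $$ (k, i)) * u $ k * conjugate (v $ i))"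
      using u v by (simp add: adj scalar_prod_def sum_distrib_right atLeast0LessThan)
    also have "\<dots> = (\<Sum>k<m. \<Sum>i<n. conjugate (W $$ (k, i)) * u $ k * conjugate (v $ i))"
      by (rule sum.swap)
    also have "\<dots> = (\<Sum>k<m. u $ k * conjugate (\<Sum>i<n. W $$ (k, i) * v $ i))"
      by (simp add: sum_conjugate conjugate_dist_mul sum_distrib_left ac_simps)
    also have "\<dots> = u \<bullet>c u"
      using W v by (simp add: u_def scalar_prod_def atLeast0LessThan)
    finally show ?thesis by (metis conjugate_square_ge_0_vec)
  qed
  ultimately show ?thesis by (simp add: psd_mat_def)
qed

subsection \<open>Isomorphisms\<close>

text \<open>\<open>digraph_iso\<close> involves separate vertex and arc maps together with head and
  tail functions. Between pair digraphs the vertex map determines the rest.\<close>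

lemma digraph_iso_with_proj_iff:
  assumes "pair_wf_digraph G" "pair_wf_digraph H"
  shows "digraph_iso (with_proj G) (with_proj H) \<longleftrightarrow>
    (\<exists>f. bij_betw f (pverts G) (pverts H) \<and>
      (\<forall>u\<in>pverts G. \<forall>v\<in>pverts G. (u, v) \<in> parcs G \<longleftrightarrow> (f u, f v) \<in> parcs H))"
    (is "?iso \<longleftrightarrow> ?bij")
proof -
  interpret G: pair_wf_digraph G by fact
  interpret H: pair_wf_digraph H by fact
  show ?thesis
  proof
    assume ?iso
    then obtain h where h: "pre_digraph.digraph_isomorphism (with_proj G) h"
      and H: "with_proj H = app_iso h (with_proj G)" by (auto simp: digraph_iso_def)
    let ?f = "iso_verts h"
    have inj: "inj_on ?f (pverts G)"
      using h by (simp add: pre_digraph.digraph_isomorphism_def)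
    have verts: "pverts H = ?f ` pverts G" and arcs: "parcs H = iso_arcs h ` parcs G"
      and "iso_tail h = fst" "iso_head h = snd"
      using arg_cong[OF H, of verts] arg_cong[OF H, of arcs]
        arg_cong[OF H, of tail] arg_cong[OF H, of head] by auto
    \<comment> \<open>As tail and head in the image are \<open>fst\<close> and \<open>snd\<close>,
      the arc map must apply the vertex map to both ends.\<close>
    then have arc: "iso_arcs h (u, v) = (?f u, ?f v)" if "(u, v) \<in> parcs G" for u v
      using h that by (auto simp: pre_digraph.digraph_isomorphism_def intro!: prod_eqI)
    have "(u, v) \<in> parcs G \<longleftrightarrow> (?f u, ?f v) \<in> parcs H"
      if uv: "u \<in> pverts G" "v \<in> pverts G" for u v
    proof
      assume "(?f u, ?f v) \<in> parcs H"
      then obtain u' v' where e: "(u', v') \<in> parcs G" "(?f u, ?f v) = iso_arcs h (u', v')"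
        unfolding arcs by auto
      then have "?f u = ?f u'" "?f v = ?f v'" using arc by auto
      then show "(u, v) \<in> parcs G"
        using e(1) uv inj G.in_arcsD1 G.in_arcsD2 by (metis inj_onD)
    qed (use arc arcs in force)
    with inj verts show ?bij by (auto simp: bij_betw_def)
  next
    assume ?bij
    then obtain f where f: "bij_betw f (pverts G) (pverts H)"
      and arcs: "\<And>u v. u \<in> pverts G \<Longrightarrow> v \<in> pverts G \<Longrightarrow> (u, v) \<in> parcs G \<longleftrightarrow> (f u, f v) \<in> parcs H"
      by auto
    define h where "h = \<lparr>iso_verts = f, iso_arcs = map_prod f f, iso_head = snd, iso_tail = fst\<rparr>"
    have inj: "inj_on f (pverts G)" and img: "pverts H = f ` pverts G"
      using f by (auto simp: bij_betw_def)
    have "inj_on (map_prod f f) (parcs G)"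
      using map_prod_inj_on[OF inj inj] by (rule inj_on_subset) (auto dest: G.in_arcsD1 G.in_arcsD2)
    then have "pre_digraph.digraph_isomorphism (with_proj G) h"
      using inj G.wf_digraph_axioms by (auto simp: pre_digraph.digraph_isomorphism_def h_def)
    moreover have "parcs H = map_prod f f ` parcs G"
    proof (intro equalityI subsetI)
      fix e assume e: "e \<in> parcs H"
      then have "fst e \<in> f ` pverts G" "snd e \<in> f ` pverts G"
        using H.arc_fst_in_verts H.arc_snd_in_verts img by auto
      then obtain u v where "u \<in> pverts G" "v \<in> pverts G" "e = (f u, f v)"
        by (metis imageE prod.collapse)
      with e show "e \<in> map_prod f f ` parcs G" using arcs by force
    qed (auto simp: arcs[symmetric] G.in_arcsD1 G.in_arcsD2)
    ultimately show ?iso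
      by (auto simp: digraph_iso_def app_iso_def with_proj_def h_def img intro!: exI[of _ h])
  qed
qed

subsection \<open>The prism graph\<close>

lemma pverts_prism: "pverts (cycle_graph 3 \<box> path_graph n) = {..<3} \<times> {..<n}"
  by (simp add: cart_prod_def cycle_graph_def path_graph_def)

text \<open>The triangle is a complete graph, so adjacency inside a layer is mere
  distinctness.\<close>

lemma parcs_cycle_graph_3: "(a, b) \<in> parcs (cycle_graph 3) \<longleftrightarrow> a < 3 \<and> b < 3 \<and> a \<noteq> b"
  by (auto simp: cycle_graph_def mod_Suc)

lemma parcs_prism:
  assumes "a < 3" "b < 3" "x < n" "y < n"
  shows "((a, x), (b, y)) \<in> parcs (cycle_graph 3 \<box> path_graph n) \<longleftrightarrow>
    (x = y \<and> a \<noteq> b) \<or> (a = b \<and> (y = Suc x \<or> x = Suc y))"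
  using assms
  by (auto simp: cart_prod_def parcs_cycle_graph_3) (auto simp: path_graph_def cycle_graph_def)

lemma pair_graph_prism: "pair_graph (cycle_graph 3 \<box> path_graph n)"
  by (intro pair_graph_cart_prod pair_graph_cycle_graph pair_graph_path_graph) simp

lemma card_pverts_prism: "card (pverts (cycle_graph 3 \<box> path_graph n)) = 3 * n"
  by (simp add: pverts_prism)

text \<open>The layerwise numbering, used with \<open>k = 3\<close>: the quotient is the layer, the
  remainder the position in the triangle.\<close>

lemma bij_betw_mod_div:
  assumes "0 < (k::nat)"
  shows "bij_betw (\<lambda>i. (i mod k, i div k)) {..<k * n} ({..<k} \<times> {..<n})"
proof (rule bij_betw_byWitness[where f' = "\<lambda>(a, x). x * k + a"])
  show "(\<lambda>(a, x). x * k + a) ` ({..<k} \<times> {..<n}) \<subseteq> {..<k * n}"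
  proof clarsimp
    fix a x assume "a < k" "x < n"
    then have "x * k + a < Suc x * k" "Suc x * k \<le> n * k" by (simp, intro mult_le_mono1) simp
    then show "x * k + a < k * n" by (simp add: mult.commute)
  qed
qed (use assms in \<open>auto simp: less_mult_imp_div_less mult.commute\<close>)

text \<open>For \<open>i = 3x + a\<close>, the row is taken at vertex \<open>(a, x)\<close> and the
  column at \<open>(a, x + 1)\<close>. If \<open>i < j = 3y + b\<close>, then
  \<open>x < y + 1\<close>, so a nonzero entry would need a path edge, that is \<open>a = b\<close>
  and \<open>x = y\<close>, which forces \<open>i = j\<close>.\<close>

lemma rank_prism_ge:
  fixes B :: "'k::conjugatable_ordered_field mat"
  assumes B: "hermitian_mat (3 * n) B"
    and iso: "digraph_iso (with_proj (mat_graph B)) (with_proj (cycle_graph 3 \<box> path_graph n))"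
  shows "3 * n - 3 \<le> vec_space.rank (3 * n) B"
proof -
  let ?G = "cycle_graph 3 \<box> path_graph n"
  have carrier: "B \<in> carrier_mat (3 * n) (3 * n)" using B by (simp add: hermitian_mat_def)
  interpret M: pair_graph "mat_graph B" using B by (rule pair_graph_mat_graph)
  interpret G: pair_graph ?G by (rule pair_graph_prism)
  obtain f where f: "bij_betw f (pverts (mat_graph B)) (pverts ?G)"
    and arcs: "\<And>u v. u \<in> pverts (mat_graph B) \<Longrightarrow> v \<in> pverts (mat_graph B) \<Longrightarrow>
      (u, v) \<in> parcs (mat_graph B) \<longleftrightarrow> (f u, f v) \<in> parcs ?G"
    using iso digraph_iso_with_proj_iff[OF M.pair_wf_digraph_axioms G.pair_wf_digraph_axioms]
    by auto
  have verts: "pverts (mat_graph B) = {..<3 * n}" using carrier by (simp add: mat_graph_def)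
  \<comment> \<open>\<open>B\<close> may list the vertices in any order; \<open>g\<close> gives the
    row index of a vertex.\<close>
  define g where "g = the_inv_into (pverts (mat_graph B)) f"
  have g: "g w < 3 * n" "f (g w) = w" if "w \<in> pverts ?G" for w
    using that f f_the_inv_into_f_bij_betw[OF f, of w] bij_betw_the_inv_into[OF f]
    by (auto simp: g_def verts dest!: bij_betwE)
  have zero: "B $$ (g w, g z) = 0 \<longleftrightarrow> (w, z) \<notin> parcs ?G"
    if "w \<in> pverts ?G" "z \<in> pverts ?G" "w \<noteq> z" for w z
    using arcs[of "g w" "g z"] that g[of w] g[of z] carrier by (auto simp: verts mat_graph_def)
  define r where "r i = g (i mod 3, i div 3)" for i
  define c where "c i = g (i mod 3, Suc (i div 3))" for i
  have layer: "Suc (i div 3) < n" if "i < 3 * n - 3" for i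
    using that by linarith
  \<comment> \<open>For \<open>i \<le> j\<close> the column vertex lies in a strictly later layer,
    so the unconstrained diagonal of \<open>B\<close> is avoided.\<close>
  have entry: "B $$ (r i, c j) = 0 \<longleftrightarrow>
      ((i mod 3, i div 3), (j mod 3, Suc (j div 3))) \<notin> parcs ?G"
    if "i \<le> j" "j < 3 * n - 3" for i j
    using that layer[of i] layer[of j] div_le_mono[OF that(1), of 3] unfolding r_def c_def
    by (intro zero) (auto simp: pverts_prism)
  show ?thesis
  proof (rule vec_space.rank_ge_triangular[OF carrier, of _ r c])
    fix i assume i: "i < 3 * n - 3"
    then show "r i < 3 * n" "c i < 3 * n"
      using layer[OF i] by (auto simp: r_def c_def pverts_prism intro!: g)
    show "B $$ (r i, c i) \<noteq> 0"
      using entry[of i i] i layer[OF i] by (simp add: parcs_prism)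
  next
    fix i j assume ij: "i < j" "j < 3 * n - 3"
    then have "i div 3 \<le> j div 3" by (simp add: div_le_mono)
    moreover have "i mod 3 \<noteq> j mod 3 \<or> i div 3 \<noteq> j div 3" using ij by (metis div_mult_mod_eq less_irrefl)
    ultimately show "B $$ (r i, c j) = 0"
      using ij entry[of i j] layer[of i] layer[of j] by (auto simp: parcs_prism)
  qed
qed

text \<open>The matrix \<open>W\<close> with \<open>m = n - 1\<close> block rows:
  \<open>div 3\<close> selects the block and \<open>mod 3\<close> the position in it. The first
  branch is \<open>P\<close>, the second \<open>Q\<close>.\<close>

definition prism_factor :: "nat \<Rightarrow> 'k::comm_ring_1 mat" where
  "prism_factor m = mat (3 * m) (3 * Suc m) (\<lambda>(q, i).
     if i div 3 = q div 3 then if q mod 3 = i mod 3 then 0 else 1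
     else if i div 3 = Suc (q div 3) then if q mod 3 = i mod 3 then - 2 else 2
     else 0)"

section \<open>Entries and graph of the Gram matrix\<close>

lemma conjugate_one: "conjugate (1 :: 'k::conjugatable_field) = 1"
  by (metis conjugate_dist_mul conjugate_zero_iff mult_cancel_left1 mult_1 zero_neq_one)

lemma conjugate_2: "conjugate (2 :: 'k::conjugatable_field) = 2"
  using conjugate_dist_add[of "1 :: 'k" 1] by (simp add: conjugate_one)

lemma prism_factor_carrier: "prism_factor m \<in> carrier_mat (3 * m) (3 * Suc m)"
  by (simp add: prism_factor_def)

lemma sum_3_mult: "(\<Sum>q<3 * m. f q) = (\<Sum>k<m. f (3 * k) + f (3 * k + 1) + f (3 * k + 2))"
  for f :: "nat \<Rightarrow> 'a::comm_monoid_add"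
  by (induction m) (simp_all add: eval_nat_numeral add.assoc)

lemma sum_if_unique:
  fixes c :: "'a::comm_monoid_add" and m :: nat
  assumes "\<And>k. C k \<Longrightarrow> k = t"
  shows "(\<Sum>k<m. if C k then c else 0) = (if t < m \<and> C t then c else 0)"
proof -
  have "(\<Sum>k<m. if C k then c else 0) = (\<Sum>k<m. if k = t then if C t then c else 0 else 0)"
    using assms by (intro sum.cong) auto
  then show ?thesis by simp
qed

text \<open>The diagonal block of layer \<open>x\<close> is the sum of
  \<open>P\<^sup>2 = J + I\<close>, if \<open>x < m\<close>, and
  \<open>Q\<^sup>2 = 4(4I - J)\<close>, if \<open>0 < x\<close>. Neighbouring layers contribute
  \<open>PQ = QP = 4I\<close>.\<close>

lemma prism_factor_gram_index:
  fixes i j m :: nat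
  defines "a \<equiv> i mod 3" and "b \<equiv> j mod 3" and "x \<equiv> i div 3" and "y \<equiv> j div 3"
  assumes i: "i < 3 * Suc m" and j: "j < 3 * Suc m"
  shows "(mat_adjoint (prism_factor m) * prism_factor m) $$ (i, j) =
    (if x = y then (if x < m then if a = b then 2 else 1 else 0)
       + (if 0 < x then if a = b then 12 else - 4 else 0)
     else if a = b \<and> (y = Suc x \<or> x = Suc y) then 4 else (0 :: 'k::conjugatable_ordered_field))"
proof -
  let ?W = "prism_factor m :: 'k mat"
  have xm: "x \<le> m" "y \<le> m" using i j by (auto simp: x_def y_def)
  have ab: "a \<in> {0, 1, 2}" "b \<in> {0, 1, 2}" by (auto simp: a_def b_def)
  have conj: "conjugate (?W $$ (q, i)) = ?W $$ (q, i)" if "q < 3 * m" for q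
    using that i by (auto simp: prism_factor_def conjugate_one conjugate_2 conjugate_neg)
  have "(mat_adjoint ?W * ?W) $$ (i, j) = (\<Sum>q<3 * m. conjugate (?W $$ (q, i)) * ?W $$ (q, j))"
    using i j prism_factor_carrier[of m, where 'a = 'k]
    by (simp add: mat_adjoint_eq[OF prism_factor_carrier] scalar_prod_def atLeast0LessThan)
  also have "\<dots> = (\<Sum>q<3 * m. ?W $$ (q, i) * ?W $$ (q, j))" using conj by simp
  \<comment> \<open>Block row \<open>k\<close> meets only the layers \<open>k\<close> and
    \<open>k + 1\<close>; the four terms come from \<open>PP\<close>, \<open>QQ\<close>,
    \<open>PQ\<close> and \<open>QP\<close>.\<close>
  also have "\<dots> = (\<Sum>k<m. (if k = x \<and> k = y then if a = b then 2 else 1 else 0)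
      + (if Suc k = x \<and> Suc k = y then if a = b then 12 else - 4 else 0)
      + (if k = x \<and> Suc k = y then if a = b then 4 else 0 else 0)
      + (if k = y \<and> Suc k = x then if a = b then 4 else 0 else 0))"
    unfolding sum_3_mult
  proof (intro sum.cong refl)
    fix k assume "k \<in> {..<m}"
    then have km: "3 * k < 3 * m" "3 * k + 1 < 3 * m" "3 * k + 2 < 3 * m" by auto
    have W: "?W $$ (q, l) =
        (if l div 3 = q div 3 then if q mod 3 = l mod 3 then 0 else 1
         else if l div 3 = Suc (q div 3) then if q mod 3 = l mod 3 then - 2 else 2 else 0)"
      if "q < 3 * m" "l < 3 * Suc m" for q l
      using that by (simp add: prism_factor_def)
    have dm: "(3 * k) div 3 = k" "(3 * k + 1) div 3 = k" "(3 * k + 2) div 3 = k"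
      "(3 * k) mod 3 = 0" "(3 * k + 1) mod 3 = 1" "(3 * k + 2) mod 3 = 2" by presburger+
    show "?W $$ (3 * k, i) * ?W $$ (3 * k, j) + ?W $$ (3 * k + 1, i) * ?W $$ (3 * k + 1, j)
        + ?W $$ (3 * k + 2, i) * ?W $$ (3 * k + 2, j) =
      (if k = x \<and> k = y then if a = b then 2 else 1 else 0)
      + (if Suc k = x \<and> Suc k = y then if a = b then 12 else - 4 else 0)
      + (if k = x \<and> Suc k = y then if a = b then 4 else 0 else 0)
      + (if k = y \<and> Suc k = x then if a = b then 4 else 0 else 0)"
      unfolding W[OF km(1) i] W[OF km(1) j] W[OF km(2) i] W[OF km(2) j] W[OF km(3) i] W[OF km(3) j]
        dm a_def[symmetric] b_def[symmetric] x_def[symmetric] y_def[symmetric]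
      using ab by (elim insertE emptyE; hypsubst; simp)
  qed
  \<comment> \<open>The subtraction in \<open>x - 1\<close> is truncated; the test
    \<open>Suc (x - 1) = x\<close> discards \<open>x = 0\<close>.\<close>
  also have "\<dots> = (if x < m \<and> x = y then if a = b then 2 else 1 else 0)
      + (if x - 1 < m \<and> Suc (x - 1) = x \<and> Suc (x - 1) = y then if a = b then 12 else - 4 else 0)
      + (if x < m \<and> Suc x = y then if a = b then 4 else 0 else 0)
      + (if y < m \<and> Suc y = x then if a = b then 4 else 0 else 0)"
    unfolding sum.distrib
    by (subst sum_if_unique[where t = x], force, subst sum_if_unique[where t = "x - 1"], force,
        subst sum_if_unique[where t = x], force, subst sum_if_unique[where t = y], force) auto
  also have "\<dots> = (if x = y then (if x < m then if a = b then 2 else 1 else 0)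
       + (if 0 < x then if a = b then 12 else - 4 else 0)
     else if a = b \<and> (y = Suc x \<or> x = Suc y) then 4 else 0)"
    using xm by auto
  finally show ?thesis .
qed

text \<open>\<open>ring_char_0\<close> keeps the entries \<open>1\<close>, \<open>-4\<close>,
  \<open>-3\<close> and \<open>4\<close> nonzero. For \<open>m = 0\<close> the only layer would
  receive neither block and lose its triangle.\<close>

lemma prism_factor_gram_iso:
  fixes m :: nat
  assumes m: "0 < m"
  defines "B \<equiv> mat_adjoint (prism_factor m) * prism_factor m ::
    'k::{conjugatable_ordered_field, ring_char_0} mat"
  shows "digraph_iso (with_proj (mat_graph B)) (with_proj (cycle_graph 3 \<box> path_graph (Suc m)))"
proof -
  let ?G = "cycle_graph 3 \<box> path_graph (Suc m)"
  have psd: "psd_mat (3 * Suc m) B"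
    unfolding B_def by (rule psd_mat_gram[OF prism_factor_carrier])
  then have herm: "hermitian_mat (3 * Suc m) B" by (simp add: psd_mat_def)
  then have carrier: "B \<in> carrier_mat (3 * Suc m) (3 * Suc m)" by (simp add: hermitian_mat_def)
  interpret M: pair_graph "mat_graph B" using herm by (rule pair_graph_mat_graph)
  interpret G: pair_graph ?G by (rule pair_graph_prism)
  let ?f = "\<lambda>i::nat. (i mod 3, i div 3)"
  have verts: "pverts (mat_graph B) = {..<3 * Suc m}" using carrier by (simp add: mat_graph_def)
  have bij: "bij_betw ?f (pverts (mat_graph B)) (pverts ?G)"
    unfolding verts pverts_prism by (rule bij_betw_mod_div) simp
  have "(i, j) \<in> parcs (mat_graph B) \<longleftrightarrow> (?f i, ?f j) \<in> parcs ?G"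
    if ij: "i < 3 * Suc m" "j < 3 * Suc m" for i j
  proof -
    have "i = j \<longleftrightarrow> i mod 3 = j mod 3 \<and> i div 3 = j div 3" by (metis div_mult_mod_eq)
    then have "(i, j) \<in> parcs (mat_graph B) \<longleftrightarrow>
        (i mod 3 \<noteq> j mod 3 \<or> i div 3 \<noteq> j div 3) \<and> B $$ (i, j) \<noteq> 0"
      using ij carrier by (auto simp: mat_graph_def)
    moreover have "i div 3 < Suc m" "j div 3 < Suc m" using ij by (auto intro: less_mult_imp_div_less)
    ultimately show ?thesis
      using m unfolding B_def prism_factor_gram_index[OF ij]
      by (subst parcs_prism) auto
  qed
  with bij show ?thesis
    unfolding digraph_iso_with_proj_iff[OF M.pair_wf_digraph_axioms G.pair_wf_digraph_axioms]
    by (intro exI[of _ ?f]) (auto simp: verts)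
qed

text \<open>Proved over a general field so that the real and complex cases are two
  instances.\<close>

lemma mr_plus_prism:
  assumes "n \<ge> 2"
  shows "mr_plus TYPE('k::{conjugatable_ordered_field, ring_char_0})
    (cycle_graph 3 \<box> path_graph n) = 3 * n - 3"
proof -
  let ?G = "cycle_graph 3 \<box> path_graph n"
  let ?R = "{vec_space.rank (3 * n) B | B :: 'k mat.
    psd_mat (3 * n) B \<and> digraph_iso (with_proj (mat_graph B)) (with_proj ?G)}"
  define B :: "'k mat" where "B = mat_adjoint (prism_factor (n - 1)) * prism_factor (n - 1)"
  have n: "Suc (n - 1) = n" and n1: "0 < n - 1" using assms by auto
  have W: "(prism_factor (n - 1) :: 'k mat) \<in> carrier_mat (3 * (n - 1)) (3 * n)"
    using prism_factor_carrier[of "n - 1"] n by simp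
  have "psd_mat (3 * n) B"
    unfolding B_def by (rule psd_mat_gram[OF W])
  moreover have "digraph_iso (with_proj (mat_graph B)) (with_proj ?G)"
    using prism_factor_gram_iso[OF n1, where 'k = 'k] unfolding n B_def .
  ultimately have B: "vec_space.rank (3 * n) B \<in> ?R" by blast
  have "vec_space.rank (3 * n) B \<le> 3 * (n - 1)"
    unfolding B_def using W
    by (intro vec_space.rank_mult_le[of _ _ "3 * (n - 1)"]) (simp_all only: mat_adjoint_eq[OF W] mat_carrier)
  then have "Inf ?R \<le> 3 * n - 3"
    using cInf_lower[OF B] by (simp add: diff_mult_distrib2)
  moreover have "3 * n - 3 \<le> Inf ?R"
  proof (rule cInf_greatest)
    \<comment> \<open>The Gram matrix supplies a member, so the infimum is an attained minimum and
      not a default value.\<close>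
    show "?R \<noteq> {}" using B by blast
  qed (auto simp: psd_mat_def intro: rank_prism_ge)
  ultimately show ?thesis by (simp add: mr_plus_def card_pverts_prism)
qed

theorem corollary3p8:
  fixes n :: nat
  assumes "n \<ge> 2"
  shows "mr_plus TYPE(real) (cycle_graph 3 \<box> path_graph n) = 3 * n - 3 \<and>
         mr_plus TYPE(complex) (cycle_graph 3 \<box> path_graph n) = 3 * n - 3"
  using assms by (simp add: mr_plus_prism)

end
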